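(* Let $q$ be a prime power and let $n,k$ be integers with $1\le k\le n$. The number of Hermitian LCD $[n,k]_{q^2}$ codes is $$|{\rm HLCD}[n,k]_{q^2}|=q^{k(n-k)}\prod_{i=1}^{k}\frac{q^{n-k+i}-(-1)^{n-k+i}} {q^i-(-1)^i}.$$
   Context: $\mathbb{F}_{q^2}$ is the field with $q^2$ elements. A linear $[n,k]_{q^2}$ code is a $k$-dimensional subspace $C$ of $\mathbb{F}_{q^2}^n$. The Hermitian inner product is $\langle \mathbf{x},\mathbf{y}\rangle_{\rm H}=\sum_{i=1}^n x_iy_i^q$, and $C^{\perp_{\rm H}}=\{\mathbf{y}\in\mathbb{F}_{q^2}^n : \langle \mathbf{x},\mathbf{y}\rangle_{\rm H}=0 \text{ for all } \mathbf{x}\in C\}$. The code $C$ is Hermitian LCD if $C\cap C^{\perp_{\rm H}}=\{\mathbf{0}\}$. ${\rm HLCD}[n,k]_{q^2}$ denotes the set of all Hermitian LCD $[n,k]_{q^2}$ codes (distinct subspaces are counted as distinct codes). *)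

theory Defs
  imports "HOL-Analysis.Analysis" "HOL-Number_Theory.Prime_Powers"
begin

text \<open>
  The field with q^2 elements is a type 'a of class field and finite with CARD('a) = q^2;
  the ambient space of row vectors of length n is 'a ^ 'n with CARD('n) = n.  The number q
  cannot be read off the type 'a, so it is an explicit parameter.  Subspaces and
  dimensions are those of 'a ^ 'n over 'a (the prefix vec), not over the reals.
\<close>

definition linear_code :: "nat \<Rightarrow> ('a::field ^ 'n) set \<Rightarrow> bool" where
  "linear_code k C \<longleftrightarrow> vec.subspace C \<and> vec.dim C = k"

definition hermitian_inner :: "nat \<Rightarrow> 'a::field ^ 'n \<Rightarrow> 'a ^ 'n \<Rightarrow> 'a" where
  "hermitian_inner q x y = (\<Sum>i\<in>UNIV. x $ i * (y $ i) ^ q)"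

definition hermitian_dual :: "nat \<Rightarrow> ('a::field ^ 'n) set \<Rightarrow> ('a ^ 'n) set" where
  "hermitian_dual q C = {y. \<forall>x\<in>C. hermitian_inner q x y = 0}"

definition hermitian_LCD :: "nat \<Rightarrow> ('a::field ^ 'n) set \<Rightarrow> bool" where
  "hermitian_LCD q C \<longleftrightarrow> C \<inter> hermitian_dual q C = {0}"

definition HLCD :: "nat \<Rightarrow> nat \<Rightarrow> ('a::field ^ 'n) set set" where
  "HLCD q k = {C. linear_code k C \<and> hermitian_LCD q C}"

end

theory Submission
  imports Defs "HOL-Number_Theory.Residues"
begin

text \<open>
  Count orthonormal \<open>k\<close>-tuples in the ambient space in two ways.  An orthonormal tuple spans a
  Hermitian LCD code of dimension \<open>k\<close>, so the tuples are partitioned according to their spans.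
  Splitting off a unit vector \<open>x\<close> from an LCD subspace \<open>W\<close> leaves an LCD subspace of dimension one
  less, whence the number of orthonormal \<open>k\<close>-tuples in \<open>W\<close> is a product of numbers of unit vectors.
  The same splitting, together with the fact that the norm \<open>a \<mapsto> a\<^sup>q \<^sup>+ \<^sup>1\<close> maps the units onto the
  nonzero elements of the subfield with \<open>q\<close> elements with all fibres of size \<open>q + 1\<close>, gives a
  recursion for the number of unit vectors in an LCD subspace of dimension \<open>m\<close>, which is
  \<open>q\<^sup>m (q\<^sup>m - (-1)\<^sup>m) / q\<close>.
\<close>

section \<open>Cardinalities in finite fields and their vector spaces\<close>

text \<open>Multiplication by a nonzero \<open>x\<close> permutes the units, so it leaves their
  product unchanged.\<close>

lemma finite_field_power_CARD:
  fixes x :: "'a::{field,finite}"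
  shows "x ^ CARD('a) = x"
proof (cases "x = 0")
  case False
  have "x * (\<Prod>y\<in>UNIV-{0}. x * y) = x * x ^ (CARD('a) - 1) * \<Prod>(UNIV-{0})"
    by (simp add: prod.distrib mult_ac)
  also have "x * x ^ (CARD('a) - 1) = x ^ CARD('a)"
    by (metis power_eq_if zero_less_card_finite less_numeral_extra(3))
  also have "(\<Prod>y\<in>UNIV-{0}. x * y) = (\<Prod>y\<in>UNIV-{0}. y)"
    by (rule prod.reindex_bij_witness[of _ "\<lambda>y. y / x" "\<lambda>y. x * y"]) (use False in auto)
  finally show ?thesis
    by simp
qed simp

text \<open>Adjoining an independent vector \<open>x\<close> to \<open>S\<close> multiplies the span
  by a factor \<open>CARD('a)\<close>, since \<open>(a, y)\<close> and \<open>a *s x + y\<close>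
  determine each other for \<open>y\<close> in the span of \<open>S\<close>.\<close>

lemma card_subspace:
  fixes W :: "('a::{field,finite} ^ 'n::finite) set"
  assumes "vec.subspace W"
  shows "card W = CARD('a) ^ vec.dim W"
proof -
  have span: "card (vec.span S) = CARD('a) ^ card S" if "vec.independent S"
    for S :: "('a ^ 'n) set"
    using finite[of S] that
  proof (induction S rule: finite_induct)
    case (insert x S)
    have x: "x \<notin> vec.span S" and ind: "vec.independent S"
      using insert.prems insert.hyps by (auto simp: vec.independent_insert)
    have inj: "inj_on (\<lambda>(a, y). a *s x + y) (UNIV \<times> vec.span S)"
    proof (rule inj_onI, clarify)
      fix a b y z
      assume *: "y \<in> vec.span S" "z \<in> vec.span S" "a *s x + y = b *s x + z"
      then have "(a - b) *s x = z - y"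
        by (simp add: vec.scale_left_diff_distrib algebra_simps)
      then have "(a - b) *s x \<in> vec.span S"
        using * by (simp add: vec.span_diff)
      with x have "a = b"
        using vec.span_scale[of "(a - b) *s x" S "inverse (a - b)"]
        by (cases "a = b") (simp_all del: vector_sub_rdistrib)
      with * show "a = b \<and> y = z"
        by simp
    qed
    have img: "vec.span (insert x S) = (\<lambda>(a, y). a *s x + y) ` (UNIV \<times> vec.span S)"
      (is "?L = ?R")
    proof
      show "?L \<subseteq> ?R"
      proof
        fix v assume "v \<in> ?L"
        then obtain a where "v - a *s x \<in> vec.span S"
          using vec.span_breakdown_eq by blast
        then show "v \<in> ?R"
          by (intro image_eqI[of _ _ "(a, v - a *s x)"]) auto
      qed
      have "a *s x + y \<in> ?L" if "y \<in> vec.span S" for a y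
        using that vec.span_breakdown_eq[of "a *s x + y" x S] by (auto intro!: exI[of _ a])
      then show "?R \<subseteq> ?L"
        by auto
    qed
    show ?case
      unfolding img using insert ind
      by (simp add: card_image[OF inj] card_cartesian_product)
  qed simp
  obtain B where "B \<subseteq> W" "vec.independent B" "W \<subseteq> vec.span B" "card B = vec.dim W"
    using vec.basis_exists by blast
  moreover have "vec.span B = W"
    using calculation assms by (simp add: subset_antisym vec.span_minimal)
  ultimately show ?thesis
    using span by metis
qed

section \<open>Conjugation and norm of the quadratic extension\<close>

locale quadratic_extension =
  fixes q :: nat and F :: "'a::{field,finite} itself"
  assumes primepow_q: "primepow q" and card_field: "CARD('a) = q ^ 2"
begin

lemma q_ge_2: "q \<ge> 2"
  using primepow_gt_Suc_0[OF primepow_q] by simp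

text \<open>Makes \<open>x ^ q\<close> an iterate of the Frobenius map, hence additive. The
  characteristic is the prime below \<open>q\<close> because it divides
  \<open>CARD('a)\<close>.\<close>

lemma q_eq_CHAR_power: "\<exists>m. q = CHAR('a) ^ m"
proof -
  obtain p j where p: "prime p" "q = p ^ j"
    using primepow_q by (auto simp: primepow_def)
  have "prime CHAR('a)"
    by (simp add: prime_CHAR_semidom finite_imp_CHAR_pos)
  moreover have "CHAR('a) dvd p ^ (j * 2)"
    using CHAR_dvd_CARD[where 'a = 'a] card_field p by (simp add: power_mult)
  ultimately have "CHAR('a) = p"
    using p by (metis prime_dvd_power primes_dvd_imp_eq)
  with p show ?thesis by auto
qed

lemma conj_sum: "sum f A ^ q = (\<Sum>i\<in>A. (f i :: 'a) ^ q)"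
  using q_eq_CHAR_power freshmans_dream_sum'[where 'a = 'a]
  by (metis prime_CHAR_semidom finite_imp_CHAR_pos finite)

lemma conj_add: "((x :: 'a) + y) ^ q = x ^ q + y ^ q"
  using q_eq_CHAR_power freshmans_dream'[where 'a = 'a]
  by (metis prime_CHAR_semidom finite_imp_CHAR_pos finite)

lemma conj_conj [simp]: "((x :: 'a) ^ q) ^ q = x"
  using finite_field_power_CARD[of x] card_field by (simp add: power_mult power2_eq_square)

lemma conj_eq_0_iff [simp]: "(x :: 'a) ^ q = 0 \<longleftrightarrow> x = 0"
  using q_ge_2 by simp

text \<open>The subfield with \<open>q\<close> elements. Root counting gives only an upper bound for
  its size; equality comes out of the count of norms.\<close>

definition fixed :: "'a set" where
  "fixed = {c. c ^ q = c}"

lemma zero_in_fixed [simp]: "0 \<in> fixed"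
  using q_ge_2 by (simp add: fixed_def)

lemma card_fixed_le: "card fixed \<le> q"
proof -
  \<comment> \<open>The roots of \<open>X ^ q - X\<close> are the elements of \<open>fixed\<close>;
    it is nonzero because \<open>q\<close> differs from 1.\<close>
  define p :: "'a poly" where "p = Polynomial.monom 1 q - Polynomial.monom 1 1"
  have "Polynomial.coeff p q = 1"
    using q_ge_2 by (simp add: p_def)
  then have "p \<noteq> 0" by auto
  then have "card {x. poly p x = 0} \<le> degree p"
    by (rule card_poly_roots_bound)
  also have "degree p \<le> q"
    unfolding p_def using q_ge_2
    by (intro degree_diff_le) (auto simp: degree_monom_eq)
  also have "{x. poly p x = 0} = fixed"
    by (simp add: p_def poly_monom fixed_def)
  finally show ?thesis .
qed

lemma card_norm_fibre_le: "card {a :: 'a. a ^ (q + 1) = c} \<le> q + 1"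
proof -
  define p :: "'a poly" where "p = Polynomial.monom 1 (q + 1) - [:c:]"
  have "Polynomial.coeff p (q + 1) = 1"
    by (simp add: p_def)
  then have "p \<noteq> 0" by auto
  then have "card {x. poly p x = 0} \<le> degree p"
    by (rule card_poly_roots_bound)
  also have "degree p \<le> q + 1"
    unfolding p_def by (intro degree_diff_le) (auto simp: degree_monom_eq)
  also have "{x. poly p x = 0} = {a. a ^ (q + 1) = c}"
    by (simp add: p_def poly_monom)
  finally show ?thesis .
qed

lemma norm_in_fixed: "(a :: 'a) ^ (q + 1) \<in> fixed"
  using conj_conj[of a] by (simp add: fixed_def power_mult_distrib mult.commute)

text \<open>
  The \<open>q\<^sup>2 - 1\<close> units are distributed by the norm over at most \<open>q - 1\<close> fibres of size at most
  \<open>q + 1\<close>, so both bounds are attained.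
\<close>

lemma norm_fibres:
  shows card_fixed: "card fixed = q"
    and card_norm_fibre: "c \<in> fixed \<Longrightarrow> c \<noteq> 0 \<Longrightarrow> card {a :: 'a. a ^ (q + 1) = c} = q + 1"
proof -
  let ?K = "fixed - {0}" and ?f = "\<lambda>c. {a :: 'a. a ^ (q + 1) = c}"
  have K_le: "card ?K \<le> q - 1"
    using card_fixed_le by (simp add: card_Diff_singleton)
  have "(\<Sum>c\<in>?K. card {a \<in> UNIV - {0}. a ^ (q + 1) = c}) = card (UNIV - {0 :: 'a})"
    unfolding card_eq_sum using norm_in_fixed by (intro sum.group) auto
  also have "\<dots> = (q - 1) * (q + 1)"
    using card_field by (simp add: card_Diff_singleton algebra_simps power2_eq_square)
  also have "(\<Sum>c\<in>?K. card {a \<in> UNIV - {0}. a ^ (q + 1) = c}) = (\<Sum>c\<in>?K. card (?f c))"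
    by (intro sum.cong arg_cong[of _ _ card]) auto
  finally have total: "(\<Sum>c\<in>?K. card (?f c)) = (q - 1) * (q + 1)" .
  have le: "(\<Sum>c\<in>?K. card (?f c)) \<le> card ?K * (q + 1)"
    using sum_bounded_above[of ?K "\<lambda>c. card (?f c)" "q + 1"] card_norm_fibre_le by simp
  with total have "q - 1 \<le> card ?K"
    by (metis mult_le_cancel2 add_gr_0 zero_less_one)
  with K_le have K: "card ?K = q - 1"
    by simp
  then show "card fixed = q"
    using q_ge_2 by (simp add: card_Diff_singleton)
  show "card (?f c) = q + 1" if "c \<in> fixed" "c \<noteq> 0"
  proof (rule ccontr)
    assume "card (?f c) \<noteq> q + 1"
    then have "card (?f c) < q + 1"
      using card_norm_fibre_le[of c] by simp
    then have "(\<Sum>c\<in>?K. card (?f c)) < (\<Sum>c\<in>?K. q + 1)"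
      using that card_norm_fibre_le by (intro sum_strict_mono_ex1) auto
    with total K show False by simp
  qed
qed

lemma norm_surj:
  assumes "c \<in> fixed"
  obtains a :: 'a where "a ^ (q + 1) = c"
proof (cases "c = 0")
  case False
  then have "{a :: 'a. a ^ (q + 1) = c} \<noteq> {}"
    using card_norm_fibre[OF assms] by fastforce
  then show ?thesis using that by auto
qed (use that[of 0] in simp)

section \<open>The Hermitian form\<close>

abbreviation h :: "'a ^ 'n::finite \<Rightarrow> 'a ^ 'n \<Rightarrow> 'a" where
  "h \<equiv> hermitian_inner q"

lemma h_add_left: "h (x + y) z = h x z + h y z"
  by (simp add: hermitian_inner_def algebra_simps sum.distrib)

lemma h_add_right: "h x (y + z) = h x y + h x z"
  by (simp add: hermitian_inner_def conj_add algebra_simps sum.distrib)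

lemma h_scale_left: "h (c *s x) y = c * h x y"
  by (simp add: hermitian_inner_def sum_distrib_left mult.assoc)

lemma h_scale_right: "h x (c *s y) = c ^ q * h x y"
  by (simp add: hermitian_inner_def sum_distrib_left power_mult_distrib mult_ac)

lemma h_zero [simp]: "h 0 x = 0" "h x 0 = 0"
  using q_ge_2 by (simp_all add: hermitian_inner_def power_0_left)

lemma h_commute: "h y x = h x y ^ q"
  by (simp add: hermitian_inner_def conj_sum power_mult_distrib mult.commute)

lemma h_eq_0_commute: "h y x = 0 \<longleftrightarrow> h x y = 0"
  using h_commute[of y x] conj_eq_0_iff by simp

lemma h_self_fixed: "h x x \<in> fixed"
  using h_commute[of x x] by (simp add: fixed_def)

lemma h_scale_self: "h (c *s x) (c *s x) = c ^ (q + 1) * h x x"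
  by (simp add: h_scale_left h_scale_right)

section \<open>Splitting off a unit vector\<close>

text \<open>With \<open>x\<close> in the second slot the condition is linear in \<open>y\<close>; by
  \<open>h_eq_0_commute\<close> the other order gives the same set.\<close>

definition perp :: "'a ^ 'n::finite \<Rightarrow> ('a ^ 'n) set \<Rightarrow> ('a ^ 'n) set" where
  "perp x W = {y \<in> W. h y x = 0}"

lemma subspace_perp: "vec.subspace W \<Longrightarrow> vec.subspace (perp x W)"
  unfolding vec.subspace_def perp_def by (auto simp: h_add_left h_scale_left)

text \<open>Being LCD means that the form restricted to \<open>W\<close> is nondegenerate.\<close>

lemma LCD_iff:
  assumes "vec.subspace W"
  shows "hermitian_LCD q W \<longleftrightarrow> (\<forall>y\<in>W. (\<forall>x\<in>W. h x y = 0) \<longrightarrow> y = 0)"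
  using vec.subspace_0[OF assms] by (auto simp: hermitian_LCD_def hermitian_dual_def)

text \<open>Orthogonal projection onto the line of \<open>x\<close>: as \<open>h x x = 1\<close>,
  the coefficient of \<open>w\<close> along \<open>x\<close> is \<open>h w x\<close>.\<close>

lemma bij_betw_perp:
  assumes W: "vec.subspace W" and x: "x \<in> W" "h x x = 1"
  shows "bij_betw (\<lambda>(a, y). a *s x + y) (UNIV \<times> perp x W) W"
proof (rule bij_betw_byWitness[where f' = "\<lambda>w. (h w x, w - h w x *s x)"])
  have "w - h w x *s x \<in> perp x W" if "w \<in> W" for w
  proof -
    have "h (w - h w x *s x) x = h w x - h w x * h x x"
      using h_add_left[of "w - h w x *s x" "h w x *s x" x]
      by (simp add: h_scale_left eq_diff_eq)
    then show ?thesis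
      using that W x by (simp add: perp_def vec.subspace_diff vec.subspace_scale)
  qed
  then show "(\<lambda>w. (h w x, w - h w x *s x)) ` W \<subseteq> UNIV \<times> perp x W"
    by auto
qed (use W x in \<open>auto simp: perp_def h_add_left h_scale_left vec.subspace_add vec.subspace_scale\<close>)

lemma perp_decomposition:
  assumes "vec.subspace W" "x \<in> W" "h x x = 1" and w: "w \<in> W"
  obtains a y where "y \<in> perp x W" "w = a *s x + y"
proof -
  have "w \<in> (\<lambda>(a, y). a *s x + y) ` (UNIV \<times> perp x W)"
    using bij_betw_imp_surj_on[OF bij_betw_perp[OF assms(1-3)]] w by simp
  then show ?thesis
    using that by auto
qed

lemma card_perp:
  assumes "vec.subspace W" "x \<in> W" "h x x = 1"
  shows "card W = q ^ 2 * card (perp x W)"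
  using bij_betw_same_card[OF bij_betw_perp[OF assms]] card_field
  by (simp add: card_cartesian_product)

text \<open>\<open>W\<close> and \<open>perp x W\<close> have the same radical: a vector orthogonal
  to all of \<open>W\<close> is orthogonal to \<open>x\<close>, and one in \<open>perp x W\<close>
  is orthogonal to \<open>x\<close> anyway. The forward direction serves the recursions, the
  converse builds up spans of orthonormal lists.\<close>

lemma LCD_perp_iff:
  assumes W: "vec.subspace W" and x: "x \<in> W" "h x x = 1"
  shows "hermitian_LCD q (perp x W) \<longleftrightarrow> hermitian_LCD q W"
proof
  assume L: "hermitian_LCD q W"
  show "hermitian_LCD q (perp x W)"
    unfolding LCD_iff[OF subspace_perp[OF W]]
  proof (intro ballI impI)
    fix y assume y: "y \<in> perp x W" "\<forall>z\<in>perp x W. h z y = 0"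
    have "h w y = 0" if w: "w \<in> W" for w
    proof -
      obtain a z where "z \<in> perp x W" "w = a *s x + z"
        using perp_decomposition[OF assms w] .
      then show ?thesis
        using y h_eq_0_commute[of y x] by (simp add: h_add_left h_scale_left perp_def)
    qed
    then show "y = 0"
      using L y by (auto simp: LCD_iff[OF W] perp_def)
  qed
next
  assume L: "hermitian_LCD q (perp x W)"
  show "hermitian_LCD q W"
    unfolding LCD_iff[OF W]
  proof (intro ballI impI)
    fix y assume y: "y \<in> W" "\<forall>z\<in>W. h z y = 0"
    then have "y \<in> perp x W"
      using x h_eq_0_commute[of y x] by (simp add: perp_def)
    moreover have "\<forall>z\<in>perp x W. h z y = 0"
      using y by (simp add: perp_def)
    ultimately show "y = 0"
      using L LCD_iff[OF subspace_perp[OF W]] by blast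
  qed
qed

text \<open>If all vectors were isotropic, polarisation at a pair with
  \<open>h x y \<noteq> 0\<close> would make the trace \<open>b + b ^ q\<close> vanish identically,
  which is impossible. A non-isotropic vector is then rescaled, by surjectivity of the norm.\<close>

lemma exists_unit_vector:
  assumes W: "vec.subspace W" and L: "hermitian_LCD q W" and "W \<noteq> {0}"
  obtains x where "x \<in> W" "h x x = 1"
proof -
  have "\<exists>x\<in>W. h x x \<noteq> 0"
  proof (rule ccontr)
    assume "\<not> ?thesis"
    then have iso: "h x x = 0" if "x \<in> W" for x
      using that by auto
    obtain y where y: "y \<in> W" "y \<noteq> 0"
      using \<open>W \<noteq> {0}\<close> vec.subspace_0[OF W] by auto
    obtain x where x: "x \<in> W" "h x y \<noteq> 0"
      using L y by (auto simp: LCD_iff[OF W])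
    have trace: "b + b ^ q = 0" for b :: 'a
    proof -
      \<comment> \<open>Conjugating twice is the identity, so this choice gives the cross term
        \<open>a ^ q * h x y\<close> the arbitrary value \<open>b\<close>.\<close>
      define a where "a = (b / h x y) ^ q"
      have a: "a ^ q * h x y = b"
        using x by (simp add: a_def)
      have "h (x + a *s y) (x + a *s y) = h x x + a ^ q * h x y + a * h y x + a ^ (q + 1) * h y y"
        by (simp add: h_add_left h_add_right h_scale_left h_scale_right algebra_simps)
      moreover have "a * h y x = (a ^ q * h x y) ^ q"
        by (simp add: h_commute[of y x] power_mult_distrib)
      moreover have "x + a *s y \<in> W"
        using x y W by (simp add: vec.subspace_add vec.subspace_scale)
      ultimately show ?thesis
        using iso x y a by simp
    qed
    have "b \<in> fixed" for b :: 'a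
    proof -
      \<comment> \<open>Trace zero at 1 forces characteristic 2; then \<open>b ^ q = b\<close> for
        all \<open>b\<close>, against \<open>card fixed = q\<close>.\<close>
      have "1 + 1 = (0 :: 'a)"
        using trace[of 1] by simp
      then have "b + b ^ q = b + b"
        unfolding trace using distrib_left[of b 1 1] by simp
      then show ?thesis
        unfolding fixed_def add_left_cancel by simp
    qed
    then have "fixed = UNIV" by auto
    then show False
      using card_fixed card_field q_ge_2 by (simp add: power2_eq_square)
  qed
  then obtain x where x: "x \<in> W" "h x x \<noteq> 0" by auto
  have "inverse (h x x) \<in> fixed"
    using h_self_fixed[of x] by (simp add: fixed_def power_inverse)
  then obtain c :: 'a where "c ^ (q + 1) = inverse (h x x)"
    by (rule norm_surj)
  then have "h (c *s x) (c *s x) = 1"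
    using x by (simp only: h_scale_self) simp
  with x W show ?thesis
    using that vec.subspace_scale by blast
qed

section \<open>Counting vectors by the value of \<open>h x x\<close>\<close>

text \<open>\<open>level W 1\<close> consists of the unit vectors; for a subspace \<open>W\<close>,
  \<open>level W 0\<close> includes the zero vector.\<close>

definition level :: "('a ^ 'n::finite) set \<Rightarrow> 'a \<Rightarrow> ('a ^ 'n) set" where
  "level W c = {x \<in> W. h x x = c}"

text \<open>Scaling by an \<open>a\<close> of norm \<open>c\<close> carries the unit vectors onto
  the level set of \<open>c\<close>.\<close>

lemma card_level_eq:
  assumes W: "vec.subspace W" and c: "c \<in> fixed" "c \<noteq> 0"
  shows "card (level W c) = card (level W 1)"
proof -
  obtain a :: 'a where a: "a ^ (q + 1) = c"
    using c norm_surj by blast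
  with c have "a \<noteq> 0" by auto
  have "bij_betw ((*s) a) (level W 1) (level W c)"
  proof (rule bij_betw_byWitness[where f' = "(*s) (inverse a)"])
    show "(*s) a ` level W 1 \<subseteq> level W c"
      using W a by (auto simp: level_def vec.subspace_scale h_scale_self simp del: power_Suc)
    have "inverse a ^ (q + 1) * c = 1"
      using a \<open>a \<noteq> 0\<close> c by (metis power_inverse left_inverse)
    then show "(*s) (inverse a) ` level W c \<subseteq> level W 1"
      using W by (auto simp: level_def vec.subspace_scale h_scale_self simp del: power_Suc)
  qed (use \<open>a \<noteq> 0\<close> in auto)
  then show ?thesis
    by (simp add: bij_betw_same_card)
qed

lemma card_eq_level_sum:
  assumes W: "vec.subspace W"
  shows "card W = card (level W 0) + (q - 1) * card (level W 1)"
proof -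
  have "card W = (\<Sum>c\<in>fixed. card (level W c))"
    unfolding card_eq_sum level_def using h_self_fixed by (intro sum.group[symmetric]) auto
  also have "\<dots> = card (level W 0) + (\<Sum>c\<in>fixed - {0}. card (level W c))"
    by (intro sum.remove) auto
  also have "(\<Sum>c\<in>fixed - {0}. card (level W c)) = (\<Sum>c\<in>fixed - {0}. card (level W 1))"
    by (intro sum.cong refl card_level_eq[OF W]) auto
  also have "\<dots> = (q - 1) * card (level W 1)"
    by (simp add: card_Diff_singleton card_fixed)
  finally show ?thesis .
qed

text \<open>The vector \<open>a *s x + y\<close> is isotropic iff
  \<open>h y y = - (a ^ (q + 1))\<close>. The coefficient \<open>a = 0\<close> gives the first term;
  each of the \<open>q ^ 2 - 1\<close> others asks for a nonzero value in \<open>fixed\<close>, and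
  all such level sets are equally large.\<close>

lemma card_level_0_perp:
  assumes W: "vec.subspace W" and x: "x \<in> W" "h x x = 1"
  shows "card (level W 0) = card (level (perp x W) 0) + (q ^ 2 - 1) * card (level (perp x W) 1)"
proof -
  let ?f = "\<lambda>(a, y). a *s x + y" and ?P = "perp x W"
  let ?S = "SIGMA a:UNIV. level ?P (- (a ^ (q + 1)))"
  have hf: "h (a *s x + y) (a *s x + y) = a ^ (q + 1) + h y y" if "y \<in> ?P" for a y
    using that x h_eq_0_commute[of y x]
    by (simp add: perp_def h_add_left h_add_right h_scale_left h_scale_right)
  have "bij_betw ?f ?S (level W 0)"
  proof (rule bij_betw_subset[OF bij_betw_perp[OF assms]])
    show "?S \<subseteq> UNIV \<times> ?P"
      by (auto simp: level_def)
    show "?f ` ?S = level W 0"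
    proof
      show "?f ` ?S \<subseteq> level W 0"
        using hf bij_betw_imp_surj_on[OF bij_betw_perp[OF assms]]
        by (fastforce simp: level_def simp del: power_Suc)
      show "level W 0 \<subseteq> ?f ` ?S"
      proof
        fix w assume w: "w \<in> level W 0"
        then obtain a y where "y \<in> ?P" "w = a *s x + y"
          using perp_decomposition[OF assms, of w] unfolding level_def by blast
        with w hf[of y a] show "w \<in> ?f ` ?S"
          by (intro image_eqI[of _ _ "(a, y)"])
            (auto simp: level_def eq_neg_iff_add_eq_0 add.commute)
      qed
    qed
  qed
  then have "card (level W 0) = card ?S"
    by (simp add: bij_betw_same_card)
  also have "\<dots> = (\<Sum>a\<in>UNIV. card (level ?P (- (a ^ (q + 1)))))"
    by (simp add: card_SigmaI)
  also have "\<dots> = card (level ?P 0) + (\<Sum>a\<in>UNIV - {0}. card (level ?P (- (a ^ (q + 1)))))"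
    by (subst sum.remove[of _ 0]) auto
  also have "(\<Sum>a\<in>UNIV - {0}. card (level ?P (- (a ^ (q + 1))))) =
      (\<Sum>a\<in>UNIV - {0 :: 'a}. card (level ?P 1))"
  proof (intro sum.cong refl card_level_eq[OF subspace_perp[OF W]])
    fix a :: 'a
    \<comment> \<open>Deduced from additivity at \<open>c + (- c)\<close>, so odd and even
      \<open>q\<close> are treated alike.\<close>
    have "(- c) ^ q = - (c ^ q)" for c :: 'a
      using conj_add[of c "- c"] q_ge_2 by (simp add: power_0_left eq_neg_iff_add_eq_0 add.commute)
    then show "- (a ^ (q + 1)) \<in> fixed"
      using norm_in_fixed[of a] by (simp add: fixed_def)
  qed auto
  also have "\<dots> = (q ^ 2 - 1) * card (level ?P 1)"
    using card_field by (simp add: card_Diff_singleton)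
  finally show ?thesis .
qed

text \<open>Eliminating the unit vectors of \<open>?P\<close> through the total count of
  \<open>?P\<close> leaves a recursion of the form
  \<open>N (m + 1) = (q + 1) * q ^ (2 * m) - q * N m\<close>; its coefficient \<open>- q\<close>
  produces the alternating sign.\<close>

lemma card_level_0:
  assumes "vec.subspace W" "hermitian_LCD q W" "card W = q ^ (2 * m)"
  shows "real q * card (level W 0) = q ^ (2 * m) + (- 1) ^ m * (real q - 1) * q ^ m"
  using assms
proof (induction m arbitrary: W)
  case 0
  then have "W = {0}"
    using vec.subspace_0 by (metis card_1_singletonE mult_0_right power_0 singletonD)
  then have "level W 0 = {0}"
    by (auto simp: level_def)
  then show ?case by simp
next
  case (Suc m)
  have "card W \<noteq> 1"
    using Suc.prems q_ge_2 by (simp add: power_eq_1_iff)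
  then have "W \<noteq> {0}" by auto
  then obtain x where x: "x \<in> W" "h x x = 1"
    using exists_unit_vector Suc.prems by metis
  let ?P = "perp x W"
  have P: "vec.subspace ?P" "hermitian_LCD q ?P"
    using Suc.prems x LCD_perp_iff subspace_perp by auto
  have cP: "card ?P = q ^ (2 * m)"
    using card_perp[OF Suc.prems(1) x] Suc.prems(3) q_ge_2 by (simp add: power2_eq_square)
  have 1: "real (card (level W 0)) =
      card (level ?P 0) + (real q ^ 2 - 1) * card (level ?P 1)"
    using card_level_0_perp[OF Suc.prems(1) x] q_ge_2 by (simp add: of_nat_diff)
  have 2: "real q ^ (2 * m) = card (level ?P 0) + (real q - 1) * card (level ?P 1)"
    using card_eq_level_sum[OF P(1)] cP q_ge_2
    by (metis (no_types, lifting) of_nat_1 of_nat_add of_nat_diff of_nat_mult of_nat_power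
        one_le_numeral order_trans)
  \<comment> \<open>Factoring \<open>q ^ 2 - 1\<close> exposes the product
    \<open>(q - 1) * card (level ?P 1)\<close> that the total count determines.\<close>
  have "real (card (level W 0)) =
      card (level ?P 0) + (real q + 1) * ((real q - 1) * card (level ?P 1))"
    unfolding 1 by (simp add: algebra_simps power2_eq_square)
  also have "(real q - 1) * card (level ?P 1) = real q ^ (2 * m) - card (level ?P 0)"
    using 2 by simp
  finally have "real (card (level W 0)) =
      (real q + 1) * real q ^ (2 * m) - real q * card (level ?P 0)"
    by (simp add: algebra_simps)
  also have "real q * card (level ?P 0) = q ^ (2 * m) + (- 1) ^ m * (real q - 1) * q ^ m"
    using Suc.IH[OF P cP] .
  finally have "real (card (level W 0)) = (real q + 1) * real q ^ (2 * m) -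
      (real q ^ (2 * m) + (- 1) ^ m * (real q - 1) * real q ^ m)"
    by simp
  then show ?case
    by (simp only: of_nat_power) (simp add: algebra_simps)
qed

text \<open>Real-valued because of the sign and the division; the value at \<open>m = 0\<close> is
  0.\<close>

definition unit_count :: "nat \<Rightarrow> real" where
  "unit_count m = real q ^ m * (real q ^ m - (- 1) ^ m) / q"

lemma unit_count_nonzero: "m \<ge> 1 \<Longrightarrow> unit_count m \<noteq> 0"
proof -
  assume "m \<ge> 1"
  then have "real q ^ m > 1"
    using q_ge_2 by (intro one_less_power) auto
  moreover have "(- 1) ^ m \<le> (1 :: real)"
    by (cases "even m") auto
  ultimately have "real q ^ m - (- 1) ^ m > 0"
    by linarith
  then show ?thesis
    using q_ge_2 by (simp add: unit_count_def)
qed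

lemma card_level_1:
  assumes "vec.subspace W" "hermitian_LCD q W" "card W = q ^ (2 * m)"
  shows "real (card (level W 1)) = unit_count m"
proof -
  have "real (card W) = card (level W 0) + (real q - 1) * card (level W 1)"
    using card_eq_level_sum[OF assms(1)] q_ge_2 by (simp add: of_nat_diff)
  then have "real q * card W =
      real q * card (level W 0) + (real q - 1) * (real q * card (level W 1))"
    by (simp only:) (simp add: algebra_simps)
  then have "(real q - 1) * (real q * card (level W 1)) =
      (real q - 1) * (real q ^ m * (real q ^ m - (- 1) ^ m))"
    unfolding card_level_0[OF assms] assms(3) by (simp add: algebra_simps flip: power_add mult_2)
  then have "real q * card (level W 1) = real q ^ m * (real q ^ m - (- 1) ^ m)"
    using q_ge_2 unfolding mult_cancel_left by simp
  then show ?thesis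
    using q_ge_2 by (simp add: unit_count_def eq_divide_eq mult.commute)
qed

section \<open>Orthonormal frames\<close>

text \<open>Each vector is tested only against later ones; conjugate symmetry supplies the other
  order. The recursion mirrors the passage from \<open>W\<close> to \<open>perp x W\<close>.\<close>

fun orthonormal :: "('a ^ 'n::finite) list \<Rightarrow> bool" where
  "orthonormal [] \<longleftrightarrow> True"
| "orthonormal (x # xs) \<longleftrightarrow> h x x = 1 \<and> (\<forall>y\<in>set xs. h y x = 0) \<and> orthonormal xs"

definition frames :: "nat \<Rightarrow> ('a ^ 'n::finite) set \<Rightarrow> ('a ^ 'n) list set" where
  "frames k W = {xs. length xs = k \<and> set xs \<subseteq> W \<and> orthonormal xs}"

lemma finite_frames: "finite (frames k W)"
  by (rule finite_subset[OF _ finite_lists_length_eq[of UNIV k]]) (auto simp: frames_def)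

text \<open>The head is any unit vector \<open>x\<close> of \<open>W\<close>, and the tail is any
  shorter frame in \<open>perp x W\<close>, which is LCD of dimension one less.\<close>

lemma card_frames:
  assumes "vec.subspace W" "hermitian_LCD q W" "card W = q ^ (2 * m)" "k \<le> m"
  shows "real (card (frames k W)) = (\<Prod>i = 1..k. unit_count (m - k + i))"
  using assms
proof (induction k arbitrary: W m)
  case 0
  have "frames 0 W = {[]}"
    by (auto simp: frames_def)
  then show ?case by simp
next
  case (Suc k)
  then obtain m' where m: "m = Suc m'"
    by (cases m) auto
  have "bij_betw (\<lambda>(x, xs). x # xs) (SIGMA x:level W 1. frames k (perp x W)) (frames (Suc k) W)"
    by (rule bij_betw_byWitness[where f' = "\<lambda>xs. (hd xs, tl xs)"])
      (auto simp: frames_def level_def perp_def length_Suc_conv)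
  then have "card (frames (Suc k) W) = (\<Sum>x\<in>level W 1. card (frames k (perp x W)))"
    by (simp add: card_SigmaI finite_frames flip: bij_betw_same_card)
  also have "real \<dots> = (\<Sum>x\<in>level W 1. \<Prod>i = 1..k. unit_count (m' - k + i))"
    unfolding of_nat_sum
  proof (intro sum.cong refl Suc.IH)
    fix x assume "x \<in> level W 1"
    then have x: "x \<in> W" "h x x = 1"
      by (auto simp: level_def)
    show "vec.subspace (perp x W)" "hermitian_LCD q (perp x W)"
      using Suc.prems x LCD_perp_iff subspace_perp by auto
    show "card (perp x W) = q ^ (2 * m')"
      using card_perp[OF Suc.prems(1) x] Suc.prems(3) q_ge_2 m by (simp add: power2_eq_square)
    show "k \<le> m'"
      using Suc.prems m by simp
  qed
  also have "\<dots> = unit_count m * (\<Prod>i = 1..k. unit_count (m' - k + i))"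
    by (simp add: card_level_1[OF Suc.prems(1-3)])
  \<comment> \<open>The new factor is the one at \<open>i = Suc k\<close>; the others agree since
    \<open>m - Suc k = m' - k\<close>.\<close>
  also have "\<dots> = (\<Prod>i = 1..Suc k. unit_count (m - Suc k + i))"
    using Suc.prems m by simp
  finally show ?case .
qed

text \<open>By induction, since the complement of \<open>x\<close> in the span of
  \<open>x # xs\<close> is the span of \<open>xs\<close>.\<close>

lemma span_orthonormal:
  assumes "orthonormal xs"
  shows "hermitian_LCD q (vec.span (set xs)) \<and> card (vec.span (set xs)) = q ^ (2 * length xs)"
  using assms
proof (induction xs)
  case Nil
  show ?case
    by (simp add: LCD_iff[of "{0}"])
next
  case (Cons x xs)
  let ?U = "vec.span (set xs)" and ?W = "vec.span (set (x # xs))"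
  have x: "x \<in> ?W" "h x x = 1"
    using Cons.prems by (auto simp: vec.span_base)
  have W: "vec.subspace ?W"
    by (rule vec.subspace_span)
  have orth: "h u x = 0" if "u \<in> ?U" for u
  proof -
    have "vec.span (set xs) \<subseteq> perp x UNIV"
      using Cons.prems subspace_perp[of UNIV x]
      by (intro vec.span_minimal) (auto simp: perp_def)
    with that show ?thesis
      by (auto simp: perp_def)
  qed
  have "perp x ?W = ?U"
  proof
    show "perp x ?W \<subseteq> ?U"
    proof
      fix w assume w: "w \<in> perp x ?W"
      then obtain a where a: "w - a *s x \<in> ?U"
        using vec.span_breakdown_eq[of w x "set xs"] by (auto simp: perp_def)
      \<comment> \<open>Pairing with \<open>x\<close> isolates the coefficient \<open>a\<close>,
        which vanishes because \<open>w\<close> is orthogonal to \<open>x\<close>.\<close>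
      have "h w x = h (w - a *s x) x + a * h x x"
        using h_add_left[of "w - a *s x" "a *s x" x] by (simp add: h_scale_left)
      then have "a = 0"
        using w x orth[OF a] by (simp add: perp_def)
      with a show "w \<in> ?U" by simp
    qed
    show "?U \<subseteq> perp x ?W"
      using orth vec.span_mono[of "set xs" "set (x # xs)"] by (auto simp: perp_def)
  qed
  then show ?case
    using Cons card_perp[OF W x] LCD_perp_iff[OF W x]
    by (simp add: power2_eq_square)
qed

section \<open>Counting the codes\<close>

text \<open>Trades dimension for cardinality, which determines it because
  \<open>q \<ge> 2\<close>.\<close>

lemma HLCD_iff:
  "C \<in> HLCD q k \<longleftrightarrow> vec.subspace C \<and> hermitian_LCD q C \<and> card C = q ^ (2 * k)"
  for C :: "('a ^ 'n::finite) set"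
proof -
  have "card C = q ^ (2 * vec.dim C)" if "vec.subspace C"
    using card_subspace[OF that] card_field by (simp add: power_mult)
  then show ?thesis
    using q_ge_2 by (auto simp: HLCD_def linear_code_def)
qed

text \<open>Pairing \<open>y\<close> with the standard basis vectors yields the conjugates of its
  coordinates.\<close>

lemma LCD_UNIV: "hermitian_LCD q (UNIV :: ('a ^ 'n::finite) set)"
  unfolding LCD_iff[OF vec.subspace_UNIV]
proof (intro ballI impI)
  fix y :: "'a ^ 'n" assume y: "\<forall>x\<in>UNIV. h x y = 0"
  have "y $ i = 0" for i
  proof -
    have "h (axis i 1) y = (y $ i) ^ q"
      by (simp add: hermitian_inner_def axis_def if_distrib[of "\<lambda>x. x * _"] cong: if_cong)
    with y show ?thesis by simp
  qed
  then show "y = 0"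
    by (simp add: vec_eq_iff)
qed

text \<open>Every frame of the whole space lies in exactly one code of \<open>?H\<close>, its span,
  and all these codes contain equally many frames.\<close>

lemma card_HLCD_mult:
  assumes "CARD('n::finite) = n" "k \<le> n"
  shows "real (card (HLCD q k :: ('a ^ 'n) set set)) * (\<Prod>i = 1..k. unit_count i) =
    (\<Prod>i = 1..k. unit_count (n - k + i))"
proof -
  let ?H = "HLCD q k :: ('a ^ 'n) set set"
  have span: "vec.span (set xs) \<in> ?H" if "xs \<in> frames k UNIV" for xs
    using that span_orthonormal[of xs] by (auto simp: HLCD_iff frames_def)
  have unique: "C = vec.span (set xs)" if "C \<in> ?H" "xs \<in> frames k C" for C xs
  proof -
    have "vec.span (set xs) \<subseteq> C"
      using that by (intro vec.span_minimal) (auto simp: HLCD_iff frames_def)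
    moreover have "card (vec.span (set xs)) = card C"
      using that span_orthonormal[of xs] by (auto simp: HLCD_iff frames_def)
    ultimately show ?thesis
      by (metis card_subset_eq finite)
  qed
  have "frames k UNIV = (\<Union>C\<in>?H. frames k C)"
  proof
    show "frames k UNIV \<subseteq> (\<Union>C\<in>?H. frames k C)"
    proof
      fix xs :: "('a ^ 'n) list" assume xs: "xs \<in> frames k UNIV"
      then have "xs \<in> frames k (vec.span (set xs))"
        by (auto simp: frames_def vec.span_base)
      then show "xs \<in> (\<Union>C\<in>?H. frames k C)"
        using span[OF xs] by blast
    qed
  qed (auto simp: frames_def)
  moreover have "card (\<Union>C\<in>?H. frames k C) = (\<Sum>C\<in>?H. card (frames k C))"
  proof (rule card_UN_disjoint)
    show "\<forall>C\<in>?H. \<forall>D\<in>?H. C \<noteq> D \<longrightarrow> frames k C \<inter> frames k D = {}"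
      using unique by (metis disjoint_iff)
  qed (simp_all add: finite_frames)
  ultimately have "real (card (frames k (UNIV :: ('a ^ 'n) set))) =
      (\<Sum>C\<in>?H. real (card (frames k C)))"
    by simp
  \<comment> \<open>Here \<open>m = k\<close> in \<open>card_frames\<close>, so the offset
    \<open>m - k\<close> vanishes.\<close>
  also have "\<dots> = (\<Sum>C\<in>?H. \<Prod>i = 1..k. unit_count i)"
    by (intro sum.cong refl) (simp add: HLCD_iff card_frames)
  also have "\<dots> = real (card ?H) * (\<Prod>i = 1..k. unit_count i)"
    by simp
  also have "real (card (frames k (UNIV :: ('a ^ 'n) set))) = (\<Prod>i = 1..k. unit_count (n - k + i))"
    using assms card_field
    by (intro card_frames) (auto simp: LCD_UNIV power_mult)
  finally show ?thesis by simp
qed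

end

theorem theorem3p4:
  fixes q n k :: nat
  assumes "primepow q"
    and "CARD('a::{field,finite}) = q ^ 2"
    and "CARD('n::finite) = n"
    and "1 \<le> k" and "k \<le> n"
  shows "real (card (HLCD q k :: ('a ^ 'n) set set)) =
    real q ^ (k * (n - k)) *
    (\<Prod>i = 1..k. (real q ^ (n - k + i) - (- 1) ^ (n - k + i)) / (real q ^ i - (- 1) ^ i))"
proof -
  interpret quadratic_extension q "TYPE('a)"
    using assms by unfold_locales
  have "real (card (HLCD q k :: ('a ^ 'n) set set)) =
      (\<Prod>i = 1..k. unit_count (n - k + i)) / (\<Prod>i = 1..k. unit_count i)"
    using card_HLCD_mult[OF assms(3,5)] unit_count_nonzero
    by (simp add: eq_divide_eq)
  also have "\<dots> = (\<Prod>i = 1..k. unit_count (n - k + i) / unit_count i)"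
    by (simp add: prod_dividef)
  \<comment> \<open>In each quotient the divisor \<open>q\<close> cancels and the leading powers
    leave \<open>q ^ (n - k)\<close>, independent of \<open>i\<close>.\<close>
  also have "\<dots> = (\<Prod>i = 1..k. real q ^ (n - k) *
      ((real q ^ (n - k + i) - (- 1) ^ (n - k + i)) / (real q ^ i - (- 1) ^ i)))"
    using q_ge_2 by (intro prod.cong refl) (simp add: unit_count_def power_add)
  also have "\<dots> = real q ^ (k * (n - k)) *
      (\<Prod>i = 1..k. (real q ^ (n - k + i) - (- 1) ^ (n - k + i)) / (real q ^ i - (- 1) ^ i))"
    by (simp only: prod.distrib) (simp add: power_mult mult.commute[of k])
  finally show ?thesis .
qed

end
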